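(* Let $\gamma$ be a closed wave front in the plane, regarded as a closed trajectory of the rear wheel of a bicycle of length $1$, let $\Gamma$ be the corresponding closed trajectory of the front wheel, and let $M$ be the bicycle monodromy of $\Gamma$. Then $M$ is parabolic if and only if the total algebraic length of $\gamma$ is zero.
   Context: A bicycle of length $1$ in the plane is an oriented unit segment $AB$ ($A$ is the rear wheel, $B$ the front wheel) moving so that the velocity of $A$ is always parallel to $AB$. Let the front wheel trace a smooth closed curve $\Gamma$ of length $L$, parametrized by arc length $x$ and extended $L$-periodically. Recording the position by the unit vector $u$ from $A$ to $B$, so that $A=\Gamma-u$, the motion is governed by $u'(x)=\Gamma'(x)-(\Gamma'(x)\cdot u(x))u(x)$. The monodromy $M:S^1\to S^1$ sends $u(0)$ to $u(L)$. It is a Möbius transformation of the circle (the boundary action of an orientation-preserving isometry of the hyperbolic plane), and its type (elliptic, parabolic, hyperbolic) does not depend on the starting point on $\Gamma$. An elliptic transformation is conjugate to a rotation of the circle, a parabolic one has a unique fixed point on the circle, with derivative $1$ there, and a hyperbolic one has exactly two fixed points on the circle, one exponentially attracting and the other repelling. The rear track is the curve $\gamma(x)=\Gamma(x)-u(x)$, which may have cusps (it is a wave front). It is a closed trajectory if $u(L)=u(0)$, i.e. $u(0)$ is a fixed point of $M$. Let $\alpha(x)$ be the angle such that the angle from $\Gamma'(x)$ to the vector $BA=-u(x)$ is $\pi-\alpha(x)$; thus $\cos\alpha(x)=\Gamma'(x)\cdot u(x)$ and $\gamma'(x)=\cos\alpha(x)\,u(x)$. The total algebraic (signed) length of $\gamma$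 is $\int_0^L\cos\alpha(x)\,dx$; the sign of the length element changes at each cusp.
   Formalization: The equivalence is asserted when M is not the identity; when M is the identity (e.g. the circle of radius √3/2 traversed twice), M is not parabolic although the total algebraic length is zero, and there only the vanishing of the length is asserted. *)

theory Defs
  imports "HOL-Complex_Analysis.Riemann_Mapping"
begin

text \<open>
  The plane is the type \<^typ>\<open>complex\<close>, with Euclidean inner product \<open>v \<bullet> w = Re (cnj v * w)\<close>;
  the circle of directions is \<^term>\<open>sphere 0 1 :: complex set\<close>.
\<close>

text \<open>\<open>D n\<close> is the \<open>n\<close>-th derivative; the curve is of class \<open>C\<close>-infinity.\<close>

definition smooth_curve :: "(real \<Rightarrow> complex) \<Rightarrow> bool" where
  "smooth_curve \<Gamma> \<longleftrightarrow>
     (\<exists>D. D 0 = \<Gamma> \<and> (\<forall>n x. (D n has_vector_derivative D (Suc n) x) (at x)))"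

abbreviation velocity :: "(real \<Rightarrow> complex) \<Rightarrow> real \<Rightarrow> complex" where
  "velocity \<Gamma> x \<equiv> vector_derivative \<Gamma> (at x)"

text \<open>Self-intersections and multiply traversed curves are allowed.\<close>

definition front_track :: "real \<Rightarrow> (real \<Rightarrow> complex) \<Rightarrow> bool" where
  "front_track L \<Gamma> \<longleftrightarrow>
     0 < L \<and> smooth_curve \<Gamma> \<and> (\<forall>x. \<Gamma> (x + L) = \<Gamma> x) \<and> (\<forall>x. norm (velocity \<Gamma> x) = 1)"

definition bicycle_motion :: "(real \<Rightarrow> complex) \<Rightarrow> (real \<Rightarrow> complex) \<Rightarrow> bool" where
  "bicycle_motion \<Gamma> u \<longleftrightarrow>
     (\<forall>x. norm (u x) = 1 \<and>
          (u has_vector_derivative (velocity \<Gamma> x - (velocity \<Gamma> x \<bullet> u x) *\<^sub>R u x)) (at x))"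

text \<open>
  The monodromy is meaningful on the unit circle only, where the initial value problem has a
  unique solution.
\<close>

definition monodromy :: "real \<Rightarrow> (real \<Rightarrow> complex) \<Rightarrow> complex \<Rightarrow> complex" where
  "monodromy L \<Gamma> v = (THE w. \<exists>u. bicycle_motion \<Gamma> u \<and> u 0 = v \<and> u L = w)"

text \<open>
  The orientation-preserving isometries of the hyperbolic disc are the maps
  \<^term>\<open>Moebius_function t w\<close> with \<^term>\<open>norm w < 1\<close>; their boundary action is the restriction to
  the circle.
\<close>

definition circle_moebius :: "(complex \<Rightarrow> complex) \<Rightarrow> bool" where
  "circle_moebius f \<longleftrightarrow>
     (\<exists>t w. norm w < 1 \<and> (\<forall>z\<in>sphere 0 1. f z = Moebius_function t w z))"

text \<open>
  For a Moebius transformation a unique fixed point on the circle forces the derivative there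
  to be \<open>1\<close>.
\<close>

definition parabolic :: "(complex \<Rightarrow> complex) \<Rightarrow> bool" where
  "parabolic f \<longleftrightarrow> circle_moebius f \<and> (\<exists>!z. z \<in> sphere 0 1 \<and> f z = z)"

text \<open>
  The identity is excluded from the parabolic maps, but it does occur as a monodromy: for the
  circle of radius \<open>sqrt 3 / 2\<close> traversed twice, for instance. All rear tracks are then closed
  and have algebraic length zero.
\<close>

definition circle_identity :: "(complex \<Rightarrow> complex) \<Rightarrow> bool" where
  "circle_identity f \<longleftrightarrow> (\<forall>z\<in>sphere 0 1. f z = z)"

text \<open>
  Here \<open>\<gamma> = \<Gamma> - u\<close> is the rear track, so that \<open>u = \<Gamma> - \<gamma>\<close>. Such a \<open>\<gamma>\<close> is a wave front
  with tangent direction \<open>u\<close>: \<open>\<gamma>'\<close> and \<open>u'\<close> are the orthogonal components of \<open>\<Gamma>'\<close>, a unit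
  vector, and so do not vanish simultaneously.
\<close>

definition closed_rear_track :: "real \<Rightarrow> (real \<Rightarrow> complex) \<Rightarrow> (real \<Rightarrow> complex) \<Rightarrow> bool" where
  "closed_rear_track L \<Gamma> \<gamma> \<longleftrightarrow>
     bicycle_motion \<Gamma> (\<lambda>x. \<Gamma> x - \<gamma> x) \<and> \<Gamma> L - \<gamma> L = \<Gamma> 0 - \<gamma> 0"

text \<open>
  The angle from \<open>\<Gamma>'\<close> to \<open>-u\<close> is \<open>\<pi> - \<alpha>\<close>, that is, \<open>-u = cis (\<pi> - \<alpha>) * \<Gamma>'\<close>. The angle is
  normalised to \<open>(-\<pi>, \<pi>]\<close>; only its cosine is used.
\<close>

definition steering_angle :: "(real \<Rightarrow> complex) \<Rightarrow> (real \<Rightarrow> complex) \<Rightarrow> real \<Rightarrow> real" where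
  "steering_angle \<Gamma> \<gamma> x = Arg (velocity \<Gamma> x / (\<Gamma> x - \<gamma> x))"

definition algebraic_length :: "real \<Rightarrow> (real \<Rightarrow> complex) \<Rightarrow> (real \<Rightarrow> complex) \<Rightarrow> real" where
  "algebraic_length L \<Gamma> \<gamma> = integral {0..L} (\<lambda>x. cos (steering_angle \<Gamma> \<gamma> x))"

lemma steering_angle:
  assumes "front_track L \<Gamma>" "closed_rear_track L \<Gamma> \<gamma>"
  shows "- (\<Gamma> x - \<gamma> x) = cis (pi - steering_angle \<Gamma> \<gamma> x) * velocity \<Gamma> x"
    and "cos (steering_angle \<Gamma> \<gamma> x) = velocity \<Gamma> x \<bullet> (\<Gamma> x - \<gamma> x)"
proof -
  define v where "v = velocity \<Gamma> x"
  define u where "u = \<Gamma> x - \<gamma> x"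
  define a where "a = steering_angle \<Gamma> \<gamma> x"
  have nv: "norm v = 1" and nu: "norm u = 1"
    using assms by (auto simp: front_track_def closed_rear_track_def bicycle_motion_def v_def u_def)
  have "v \<noteq> 0" "u \<noteq> 0"
    using nv nu by auto
  then have "cis a = v / u"
    using nv nu cis_Arg[of "v / u"]
    by (auto simp: a_def steering_angle_def v_def[symmetric] u_def[symmetric] sgn_div_norm norm_divide)
  with \<open>u \<noteq> 0\<close> have v: "v = cis a * u"
    by (auto simp: field_simps)
  have "cis (pi - a) * v = - u"
    by (simp add: v cis_mult flip: mult.assoc)
  then show "- (\<Gamma> x - \<gamma> x) = cis (pi - steering_angle \<Gamma> \<gamma> x) * velocity \<Gamma> x"
    by (simp add: a_def u_def v_def)
  have "v \<bullet> u = cos a * (norm u)\<^sup>2"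
    unfolding v cmod_power2 by (simp add: inner_complex_def algebra_simps power2_eq_square)
  then show "cos (steering_angle \<Gamma> \<gamma> x) = velocity \<Gamma> x \<bullet> (\<Gamma> x - \<gamma> x)"
    using nu by (simp add: a_def u_def v_def)
qed

lemma rear_track_velocity:
  assumes "front_track L \<Gamma>" "closed_rear_track L \<Gamma> \<gamma>"
  shows "(\<gamma> has_vector_derivative cos (steering_angle \<Gamma> \<gamma> x) *\<^sub>R (\<Gamma> x - \<gamma> x)) (at x)"
proof -
  obtain D where "D 0 = \<Gamma>" "\<And>n x. (D n has_vector_derivative D (Suc n) x) (at x)"
    using assms(1) by (auto simp: front_track_def smooth_curve_def)
  then have "(\<Gamma> has_vector_derivative velocity \<Gamma> x) (at x)"
    by (metis vector_derivative_at)
  moreover have "((\<lambda>x. \<Gamma> x - \<gamma> x) has_vector_derivative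
      velocity \<Gamma> x - (velocity \<Gamma> x \<bullet> (\<Gamma> x - \<gamma> x)) *\<^sub>R (\<Gamma> x - \<gamma> x)) (at x)"
    using assms(2) by (auto simp: closed_rear_track_def bicycle_motion_def)
  ultimately show ?thesis
    using has_vector_derivative_diff by (fastforce simp: steering_angle(2)[OF assms])
qed

end

theory Submission
  imports Defs
begin

text \<open>
  The bicycle equation is a Riccati equation, and the closed rear track supplies a particular
  solution \<open>u\<close>. In the coordinate \<open>y\<close> on the circle that puts \<open>u\<close> at infinity, the other motions
  satisfy the linear equation \<open>y' = c y + s / 2\<close>, where \<open>c = cos \<alpha>\<close> and \<open>s = sin \<alpha>\<close>. Hence the
  monodromy fixes infinity and acts by \<open>y \<mapsto> e\<^sup>A y + b\<close>, where \<open>A\<close> is the algebraic length.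
  If \<open>A\<close> is nonzero, there is exactly one further fixed point; if \<open>A = 0\<close>, the monodromy is a
  translation, which is either parabolic or the identity.
\<close>

section \<open>Scalar linear differential equations\<close>

lemma antiderivative_exists:
  fixes f :: "real \<Rightarrow> real"
  assumes "continuous_on UNIV f"
  obtains F where "F 0 = 0" "\<And>x. (F has_real_derivative f x) (at x)"
proof -
  have "isCont f x" for x
    using assms by (simp add: continuous_on_eq_continuous_at)
  then obtain G where G: "\<And>x. (G has_vector_derivative f x) (at x)"
    using einterval_antiderivative[of "-\<infinity>" \<infinity> f] by auto
  have "((\<lambda>x. G x - G 0) has_real_derivative f x) (at x)" for x
    using G by (auto simp: has_real_derivative_iff_has_vector_derivative intro!: derivative_eq_intros)
  then show thesis
    using that[of "\<lambda>x. G x - G 0"] by simp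
qed

text \<open>Integrating factor: \<open>g * exp (- H)\<close> is constant for any antiderivative
  \<open>H\<close> of \<open>h\<close>.\<close>

lemma linear_ode_zero:
  fixes g h :: "real \<Rightarrow> real"
  assumes "continuous_on UNIV h" and g: "\<And>x. (g has_real_derivative h x * g x) (at x)" and "g 0 = 0"
  shows "g x = 0"
proof -
  obtain H where H: "\<And>x. (H has_real_derivative h x) (at x)"
    using antiderivative_exists[OF assms(1)] by blast
  have "((\<lambda>x. g x * exp (- H x)) has_real_derivative 0) (at x)" for x
    by (rule derivative_eq_intros g H refl | simp)+
  then have "g x * exp (- H x) = g 0 * exp (- H 0)"
    using DERIV_const_ratio_const2 DERIV_isconst_all by blast
  with \<open>g 0 = 0\<close> show ?thesis
    by simp
qed

section \<open>Regularity and uniqueness of bicycle motions\<close>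

lemma front_track_velocity_continuous:
  assumes "front_track L \<Gamma>"
  shows "continuous_on UNIV (velocity \<Gamma>)"
proof -
  obtain D where D: "D 0 = \<Gamma>" "\<And>n x. (D n has_vector_derivative D (Suc n) x) (at x)"
    using assms by (auto simp: front_track_def smooth_curve_def)
  then have "velocity \<Gamma> x = D 1 x" for x
    by (metis One_nat_def vector_derivative_at)
  moreover have "continuous_on UNIV (D 1)"
    using D(2) by (meson continuous_at_imp_continuous_on has_vector_derivative_continuous)
  ultimately show ?thesis
    by simp
qed

lemma bicycle_motion_continuous:
  assumes "bicycle_motion \<Gamma> u"
  shows "continuous_on UNIV u"
  using assms unfolding bicycle_motion_def
  by (meson continuous_at_imp_continuous_on has_vector_derivative_continuous)

text \<open>For two motions, \<open>1 - u \<bullet> w\<close> satisfies a homogeneous linear equation.\<close>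

lemma bicycle_motion_unique:
  assumes v: "continuous_on UNIV (velocity \<Gamma>)"
    and u: "bicycle_motion \<Gamma> u" and w: "bicycle_motion \<Gamma> w" and "u 0 = w 0"
  shows "u = w"
proof
  fix x
  define v where "v = velocity \<Gamma>"
  have n: "norm (u x) = 1" "norm (w x) = 1" for x
    using u w by (auto simp: bicycle_motion_def)
  have uu: "u x \<bullet> u x = 1" "w x \<bullet> w x = 1" for x
    using n by (simp_all add: dot_square_norm)
  have d: "(u has_vector_derivative v x - (v x \<bullet> u x) *\<^sub>R u x) (at x)"
    "(w has_vector_derivative v x - (v x \<bullet> w x) *\<^sub>R w x) (at x)" for x
    using u w by (auto simp: bicycle_motion_def v_def)
  have "((\<lambda>x. 1 - u x \<bullet> w x) has_real_derivative - (v x \<bullet> u x + v x \<bullet> w x) * (1 - u x \<bullet> w x)) (at x)" for x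
    unfolding has_field_derivative_def
    apply (rule derivative_eq_intros d[unfolded has_vector_derivative_def] refl)+
    using uu[of x] by (auto simp: algebra_simps inner_commute fun_eq_iff)
  moreover have "continuous_on UNIV (\<lambda>x. - (v x \<bullet> u x + v x \<bullet> w x))"
    using v bicycle_motion_continuous[OF u] bicycle_motion_continuous[OF w]
    unfolding v_def by (intro continuous_intros)
  moreover have "1 - u 0 \<bullet> w 0 = 0"
    using uu \<open>u 0 = w 0\<close> by simp
  ultimately have "1 - u x \<bullet> w x = 0"
    using linear_ode_zero[where g = "\<lambda>x. 1 - u x \<bullet> w x"] by blast
  then have "(u x - w x) \<bullet> (u x - w x) = 0"
    using uu[of x] by (simp add: algebra_simps inner_commute)
  then show "u x = w x"
    by simp
qed

text \<open>Uniqueness of motions makes the definite description in \<open>monodromy\<close> denote,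
  so one explicit motion suffices to evaluate it at \<open>u 0\<close>.\<close>

lemma monodromy_eq:
  assumes "continuous_on UNIV (velocity \<Gamma>)" "bicycle_motion \<Gamma> u"
  shows "monodromy L \<Gamma> (u 0) = u L"
  unfolding monodromy_def
  using assms bicycle_motion_unique[OF assms(1)] by (intro the_equality) metis+

section \<open>A projective coordinate on the circle\<close>

text \<open>Inverse stereographic projection from 1, which corresponds to y = \<infinity>. It is
  scaled so that 1 / (1 - m) = 1/2 + i y for m = \<open>cayley y\<close>.\<close>

definition cayley :: "real \<Rightarrow> complex" where
  "cayley y = (2 * \<i> * y - 1) / (2 * \<i> * y + 1)"

lemma cayley_denom: "2 * \<i> * complex_of_real y + 1 \<noteq> 0"
  by (simp add: complex_eq_iff)

lemma norm_cayley: "norm (cayley y) = 1"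
proof -
  have "norm (2 * \<i> * complex_of_real y - 1) = norm (2 * \<i> * complex_of_real y + 1)"
    by (simp add: cmod_def)
  then show ?thesis
    using cayley_denom[of y] by (simp add: cayley_def norm_divide)
qed

lemma cayley_neq_1: "cayley y \<noteq> 1"
  by (simp add: cayley_def cayley_denom)

lemma cayley_inject: "cayley y = cayley z \<longleftrightarrow> y = z"
  using cayley_denom[of y] cayley_denom[of z]
  by (auto simp: cayley_def field_simps)

lemma cayley_surj:
  assumes "norm m = 1" "m \<noteq> 1"
  obtains y where "m = cayley y"
proof -
  obtain a b where m: "m = Complex a b"
    by (cases m)
  have ab: "a\<^sup>2 + b\<^sup>2 = 1"
    using assms(1) by (simp add: m cmod_def)
  have "a \<noteq> 1"
    using ab assms(2) by (auto simp: m complex_eq_iff)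
  \<comment> \<open>This is the imaginary part of 1 / (1 - m), since (1 - a)^2 + b^2 = 2 (1 -
    a).\<close>
  define y where "y = b / (2 * (1 - a))"
  have y: "2 * y * (1 - a) = b"
    using \<open>a \<noteq> 1\<close> by (simp add: y_def field_simps)
  have "(1 - a) * (2 * y * b) = (1 - a) * (1 + a)"
    using ab y by algebra
  then have "2 * y * b = 1 + a"
    using \<open>a \<noteq> 1\<close> by simp
  then have "m * (2 * \<i> * y + 1) = 2 * \<i> * y - 1"
    using y by (simp add: m complex_eq_iff algebra_simps)
  then have "m = cayley y"
    using cayley_denom[of y] by (simp add: cayley_def field_simps)
  then show thesis
    by (rule that)
qed

text \<open>Translations of \<open>y\<close> fix the point \<open>a\<close>, which corresponds to \<open>y = \<infinity>\<close>.\<close>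

lemma translation_is_moebius:
  assumes a: "norm a = 1"
  obtains t w where "norm w < 1" "Moebius_function t w a = a"
    "\<And>y. Moebius_function t w (a * cayley y) = a * cayley (y + b)"
proof -
  \<comment> \<open>Conjugated by \<open>cayley\<close>, the translation by b becomes z \<mapsto>
    (cnj p z + i b) / (p - i b z), of determinant |p|^2 - b^2 = 1. Its zero is \<open>w\<close>, and
    the unimodular factor left over is cnj p / p.\<close>
  define p where "p = 1 + \<i> * complex_of_real b"
  define w where "w = - \<i> * b / cnj p"
  have p: "p \<noteq> 0" "cnj p \<noteq> 0"
    by (auto simp: p_def complex_eq_iff)
  have "norm (cnj p / p) = 1"
    using p by (simp add: norm_divide)
  then obtain t where t: "exp (\<i> * complex_of_real t) = cnj p / p"
    by (metis complex_norm_eq_1_exp)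
  have aa: "a * cnj a = 1" "a \<noteq> 0"
    using a by (auto simp flip: complex_norm_square)
  have cw: "cnj w = \<i> * b / p"
    by (simp add: w_def)
  have "norm w < 1"
  proof -
    have "\<bar>b\<bar> < norm p"
      by (simp add: p_def cmod_def real_less_rsqrt)
    then show ?thesis
      using p by (simp add: w_def norm_divide norm_mult)
  qed
  \<comment> \<open>Conjugation by the rotation z \<mapsto> a z moves the fixed point from 1 to
    \<open>a\<close> and the parameter from \<open>w\<close> to \<open>a * w\<close>.\<close>
  have M: "Moebius_function t (a * w) (a * z) = a * ((cnj p * z + \<i> * b) / (p - \<i> * b * z))" for z
  proof -
    have "Moebius_function t (a * w) (a * z) = cnj p / p * (a * z - a * w) / (1 - (a * cnj a) * cnj w * z)"
      by (simp add: Moebius_function_def t mult_ac)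
    also have "\<dots> = a * (cnj p * (z - w) / (p * (1 - cnj w * z)))"
      by (simp add: aa field_simps)
    also have "cnj p * (z - w) = cnj p * z + \<i> * b"
      using p by (simp add: w_def field_simps)
    also have "p * (1 - cnj w * z) = p - \<i> * b * z"
      using p by (simp add: cw field_simps)
    finally show ?thesis .
  qed
  have "Moebius_function t (a * w) a = a"
    using M[of 1] by (simp add: p_def)
  moreover have "Moebius_function t (a * w) (a * cayley y) = a * cayley (y + b)" for y
  proof -
    \<comment> \<open>Since \<open>cayley y\<close> is 1 - 2 / r, translating y by b just adds 2 i b
      to \<open>r\<close>.\<close>
    define r where "r = 2 * \<i> * complex_of_real y + 1"
    have r: "r \<noteq> 0" "cayley y = (r - 2) / r"
      by (auto simp: r_def cayley_def cayley_denom)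
    have "cnj p * cayley y + \<i> * b = (r + 2 * \<i> * b - 2) / r"
      unfolding r(2) using r(1) by (simp add: p_def field_simps)
    moreover have "p - \<i> * b * cayley y = (r + 2 * \<i> * b) / r"
      unfolding r(2) using r(1) by (simp add: p_def field_simps)
    moreover have "cayley (y + b) = (r + 2 * \<i> * b - 2) / (r + 2 * \<i> * b)"
      by (simp add: cayley_def r_def algebra_simps)
    ultimately have "(cnj p * cayley y + \<i> * b) / (p - \<i> * b * cayley y) = cayley (y + b)"
      using r(1) by simp
    then show ?thesis
      by (simp only: M)
  qed
  moreover have "norm (a * w) < 1"
    using \<open>norm w < 1\<close> a by (simp add: norm_mult)
  ultimately show thesis
    using that by blast
qed

section \<open>The Riccati equation and its linearisation\<close>

text \<open>On the unit circle, cnj u = 1 / u makes the projection quadratic in u. This exhibits the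
  bicycle equation as the Riccati equation u' = (v - cnj v u^2) / 2.\<close>

lemma unit_projection:
  assumes "norm u = 1"
  shows "v - (v \<bullet> u) *\<^sub>R u = (v - cnj v * u\<^sup>2) / 2"
proof -
  have u: "u * cnj u = 1"
    using assms by (simp flip: complex_norm_square)
  have "complex_of_real (v \<bullet> u) = (v * cnj u + cnj v * u) / 2"
    by (simp add: complex_eq_iff inner_complex_def)
  then have "v - (v \<bullet> u) *\<^sub>R u = v - (v * (u * cnj u) + cnj v * u\<^sup>2) / 2"
    by (simp add: scaleR_conv_of_real algebra_simps power2_eq_square add_divide_distrib)
  then show ?thesis
    by (simp add: u field_simps)
qed

text \<open>For a motion u k and e = v cnj u, the Riccati equation reads k' = (1 - k) (e + cnj e k)
  / 2. The root k = 1 is the motion u itself, so 1 / (1 - k) = 1/2 + i y obeys a linear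
  equation.\<close>

lemma bicycle_motion_cayley:
  assumes u: "bicycle_motion \<Gamma> u"
    and Y: "\<And>x. (Y has_real_derivative
      Re (velocity \<Gamma> x * cnj (u x)) * Y x + Im (velocity \<Gamma> x * cnj (u x)) / 2) (at x)"
  shows "bicycle_motion \<Gamma> (\<lambda>x. u x * cayley (Y x))"
  unfolding bicycle_motion_def
proof (intro allI conjI)
  fix x
  have nu: "norm (u x) = 1"
    and u': "(u has_vector_derivative (velocity \<Gamma> x - (velocity \<Gamma> x \<bullet> u x) *\<^sub>R u x)) (at x)"
    using u by (auto simp: bicycle_motion_def)
  show nw: "norm (u x * cayley (Y x)) = 1"
    using nu by (simp add: norm_mult norm_cayley)
  define v where "v = velocity \<Gamma> x"
  \<comment> \<open>The front velocity in the moving frame of \<open>u\<close>: its real and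
    imaginary parts are the coefficients of the equation for \<open>Y\<close>.\<close>
  define e where "e = v * cnj (u x)"
  define q where "q = 2 * \<i> * complex_of_real (Y x) + 1"
  have q: "q \<noteq> 0" "cayley (Y x) = (q - 2) / q"
    by (auto simp: q_def cayley_def cayley_denom)
  have "u x * cnj (u x) = 1"
    using nu by (simp flip: complex_norm_square)
  then have ve: "v = u x * e"
    by (simp add: e_def algebra_simps)
  have cv: "cnj v * u x = cnj e"
    by (simp add: e_def)
  define q' where "q' = 2 * \<i> * complex_of_real (Re e * Y x + Im e / 2)"
  have e2: "e = Re e + \<i> * Im e" "cnj e = Re e - \<i> * Im e"
    by (simp_all add: complex_eq_iff)
  \<comment> \<open>The equation for \<open>Y\<close>, rewritten for q = 2 / (1 - k).\<close>
  have q': "q' = (e + cnj e) / 2 * q - cnj e"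
    unfolding q'_def q_def by (subst (3 4 5) e2) (simp add: complex_eq_iff)
  have Yd: "((\<lambda>x. complex_of_real (Y x)) has_vector_derivative complex_of_real (Re e * Y x + Im e / 2)) (at x)"
    using Y[of x] unfolding e_def v_def
    by (intro has_vector_derivative_of_real) (simp add: has_real_derivative_iff_has_vector_derivative)
  have "((\<lambda>x. cayley (Y x)) has_vector_derivative 2 * q' / q\<^sup>2) (at x)"
  proof -
    have "((\<lambda>z. (2 * \<i> * z - 1) / (2 * \<i> * z + 1)) has_field_derivative 4 * \<i> / q\<^sup>2) (at (complex_of_real (Y x)))"
      by (rule derivative_eq_intros refl | use q(1) in \<open>simp add: q_def power2_eq_square algebra_simps\<close>)+
    from field_vector_diff_chain_at[OF Yd this] show ?thesis
      by (simp add: o_def cayley_def q'_def add_divide_distrib algebra_simps)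
  qed
  from has_vector_derivative_mult[OF u' this]
  have "((\<lambda>x. u x * cayley (Y x)) has_vector_derivative
      u x * (2 * q' / q\<^sup>2) + (v - cnj v * (u x)\<^sup>2) / 2 * cayley (Y x)) (at x)"
    by (simp add: unit_projection nu v_def)
  \<comment> \<open>Once the factor \<open>u x\<close> is split off, only a rational identity in
    \<open>e\<close>, \<open>cnj e\<close> and \<open>q\<close> remains.\<close>
  moreover have "u x * (2 * q' / q\<^sup>2) + (v - cnj v * (u x)\<^sup>2) / 2 * cayley (Y x) =
    (v - cnj v * (u x * cayley (Y x))\<^sup>2) / 2"
  proof -
    have "cnj v * (u x)\<^sup>2 = u x * cnj e"
      using cv by (simp add: power2_eq_square algebra_simps)
    then have "v - cnj v * (u x)\<^sup>2 = u x * (e - cnj e)"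
      and "v - cnj v * (u x * k)\<^sup>2 = u x * (e - cnj e * k\<^sup>2)" for k
      by (simp_all only: power_mult_distrib mult.assoc[symmetric])
        (simp_all add: ve algebra_simps)
    moreover have "2 * q' / q\<^sup>2 + (e - cnj e) / 2 * cayley (Y x) = (e - cnj e * (cayley (Y x))\<^sup>2) / 2"
      unfolding q(2) using q(1) by (simp add: q' field_simps power2_eq_square)
    then have "u x * (2 * q' / q\<^sup>2 + (e - cnj e) / 2 * cayley (Y x)) =
        u x * ((e - cnj e * (cayley (Y x))\<^sup>2) / 2)"
      by (simp only:)
    ultimately show ?thesis
      by (simp only: distrib_left mult.assoc times_divide_eq_right times_divide_eq_left)
  qed
  ultimately show "((\<lambda>x. u x * cayley (Y x)) has_vector_derivative (velocity \<Gamma> x -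
      (velocity \<Gamma> x \<bullet> (u x * cayley (Y x))) *\<^sub>R (u x * cayley (Y x)))) (at x)"
    by (simp only: unit_projection[OF nw] v_def)
qed

text \<open>Variation of constants makes the flow affine in y. The coordinate is taken relative to
  \<open>u 0\<close> at the start and to \<open>u L\<close> at the end.\<close>

lemma monodromy_affine:
  assumes v: "continuous_on UNIV (velocity \<Gamma>)" and u: "bicycle_motion \<Gamma> u" and "0 \<le> L"
  obtains b where "\<And>y. monodromy L \<Gamma> (u 0 * cayley y) =
    u L * cayley (exp (integral {0..L} (\<lambda>x. velocity \<Gamma> x \<bullet> u x)) * y + b)"
proof -
  define c where "c = (\<lambda>x. Re (velocity \<Gamma> x * cnj (u x)))"
  define s where "s = (\<lambda>x. Im (velocity \<Gamma> x * cnj (u x)))"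
  have c: "c = (\<lambda>x. velocity \<Gamma> x \<bullet> u x)"
    by (auto simp: c_def inner_complex_def)
  have cont: "continuous_on UNIV c" "continuous_on UNIV s"
    unfolding c_def s_def using v bicycle_motion_continuous[OF u] by (auto intro!: continuous_intros)
  obtain C where C: "C 0 = 0" "\<And>x. (C has_real_derivative c x) (at x)"
    using antiderivative_exists[OF cont(1)] by blast
  have "continuous_on UNIV C"
    using C(2) DERIV_continuous_on by blast
  then have "continuous_on UNIV (\<lambda>x. exp (- C x) * s x / 2)"
    using cont by (intro continuous_intros) auto
  then obtain G where G: "G 0 = 0" "\<And>x. (G has_real_derivative exp (- C x) * s x / 2) (at x)"
    using antiderivative_exists by blast
  have "(c has_integral C L - C 0) {0..L}"
    using C \<open>0 \<le> L\<close>
    by (intro fundamental_theorem_of_calculus)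
      (auto simp flip: has_real_derivative_iff_has_vector_derivative intro: DERIV_subset)
  then have CL: "C L = integral {0..L} (\<lambda>x. velocity \<Gamma> x \<bullet> u x)"
    using C(1) by (simp add: integral_unique c)
  have "monodromy L \<Gamma> (u 0 * cayley y) = u L * cayley (exp (C L) * y + exp (C L) * G L)" for y
  proof -
    \<comment> \<open>As \<open>C\<close> and \<open>G\<close> vanish at 0, this solution starts at
      y.\<close>
    define Y where "Y = (\<lambda>x. exp (C x) * (y + G x))"
    have "(Y has_real_derivative c x * Y x + s x / 2) (at x)" for x
      unfolding Y_def
      by (rule derivative_eq_intros C G refl | simp add: algebra_simps flip: exp_add)+
    then have "bicycle_motion \<Gamma> (\<lambda>x. u x * cayley (Y x))"
      by (intro bicycle_motion_cayley[OF u]) (simp add: c_def s_def)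
    from monodromy_eq[OF v this, of L] show ?thesis
      using C(1) G(1) by (simp add: Y_def algebra_simps)
  qed
  then show thesis
    unfolding CL by (rule that)
qed

section \<open>Fixed points of the monodromy\<close>

theorem theorem3p9:
  fixes L :: real and \<Gamma> \<gamma> :: "real \<Rightarrow> complex"
  assumes "front_track L \<Gamma>"
    and "closed_rear_track L \<Gamma> \<gamma>"
  shows "(\<not> circle_identity (monodromy L \<Gamma>) \<longrightarrow>
            (parabolic (monodromy L \<Gamma>) \<longleftrightarrow> algebraic_length L \<Gamma> \<gamma> = 0))
       \<and> (circle_identity (monodromy L \<Gamma>) \<longrightarrow> algebraic_length L \<Gamma> \<gamma> = 0)"
proof -
  define u where "u = (\<lambda>x. \<Gamma> x - \<gamma> x)"
  define a where "a = u 0"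
  define A where "A = algebraic_length L \<Gamma> \<gamma>"
  define M where "M = monodromy L \<Gamma>"
  note v = front_track_velocity_continuous[OF assms(1)]
  have u: "bicycle_motion \<Gamma> u" and uL: "u L = a" and L: "0 < L"
    using assms by (auto simp: closed_rear_track_def front_track_def u_def a_def)
  have a: "norm a = 1" "a \<noteq> 0"
    using u by (auto simp: bicycle_motion_def a_def dest: spec[of _ 0])
  have "A = integral {0..L} (\<lambda>x. velocity \<Gamma> x \<bullet> u x)"
    by (simp add: A_def algebraic_length_def steering_angle(2)[OF assms] u_def)
  \<comment> \<open>Closedness, u L = u 0 = a, makes the coordinate the same at both ends.\<close>
  then obtain b where Mc: "\<And>y. M (a * cayley y) = a * cayley (exp A * y + b)"
    using monodromy_affine[OF v u, of L] L by (auto simp: uL a_def[symmetric] M_def)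
  have Ma: "M a = a"
    using monodromy_eq[OF v u, of L] by (simp add: uL a_def[symmetric] M_def)
  have circle: "z = a \<or> (\<exists>y. z = a * cayley y)" if "z \<in> sphere 0 1" for z
  proof -
    have "norm (z / a) = 1"
      using that a by (simp add: norm_divide)
    then show ?thesis
      using cayley_surj[of "z / a"] a by (cases "z = a") (auto simp: field_simps)
  qed
  have mem: "a \<in> sphere 0 1" "a * cayley y \<in> sphere 0 1" "a * cayley y \<noteq> a" for y
    using a by (auto simp: norm_mult norm_cayley cayley_neq_1)
  have fix_iff: "M (a * cayley y) = a * cayley y \<longleftrightarrow> exp A * y + b = y" for y
    using a by (simp add: Mc cayley_inject)
  \<comment> \<open>By contraposition this gives both the forward half of the equivalence and the
    clause on the identity.\<close>
  have "\<not> parabolic M \<and> \<not> circle_identity M" if "A \<noteq> 0"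
  proof -
    \<comment> \<open>The finite fixed point of y \<mapsto> e^A y + b, a second one besides
      \<open>a\<close>.\<close>
    have "exp A * (b / (1 - exp A)) + b = b / (1 - exp A)"
      using that by (simp add: field_simps)
    then have "M (a * cayley (b / (1 - exp A))) = a * cayley (b / (1 - exp A))"
      using fix_iff by blast
    then have "\<not> parabolic M"
      using mem Ma by (metis parabolic_def)
    moreover have "\<not> circle_identity M"
    proof
      assume "circle_identity M"
      then have "exp A * y + b = y" for y
        using fix_iff mem by (auto simp: circle_identity_def)
      \<comment> \<open>The value at 0 gives b = 0, and then the value at 1 gives e^A = 1.\<close>
      from this[of 0] this[of 1] show False
        using that by simp
    qed
    ultimately show ?thesis ..
  qed
  moreover have "parabolic M" if "A = 0" "\<not> circle_identity M"
  proof -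
    \<comment> \<open>For A = 0 the map is y \<mapsto> y + b; b = 0 would make every point
      fixed.\<close>
    have "b \<noteq> 0"
      using that(2) circle Ma fix_iff \<open>A = 0\<close> by (fastforce simp: circle_identity_def)
    then have "\<exists>!z. z \<in> sphere 0 1 \<and> M z = z"
      using circle mem(1) Ma fix_iff \<open>A = 0\<close> by (intro ex1I[of _ a]) fastforce+
    moreover have "circle_moebius M"
    proof -
      obtain t w where "norm w < 1" "Moebius_function t w a = a"
          "\<And>y. Moebius_function t w (a * cayley y) = a * cayley (y + b)"
        using translation_is_moebius[OF a(1), of b] by blast
      then show ?thesis
        unfolding circle_moebius_def using circle Ma Mc \<open>A = 0\<close>
        by (intro exI[of _ t] exI[of _ w]) fastforce
    qed
    ultimately show ?thesis
      by (simp add: parabolic_def)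
  qed
  ultimately show ?thesis
    unfolding A_def M_def by blast
qed

end
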